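(* Let $N\ge2$, $0<g_1<\cdots<g_N$, $f_{ij}=g_i+g_j$ for $i\ne j$. Let $\mathcal T^\circ$ be the interior of the moment simplex, $A_N(U)$ the moment diffusion matrix and $H(U)=D^2h(U)$ the Hessian of the mixing entropy $h(U)=\sum_{i=1}^Ny_i(U)\log y_i(U)$. Then, for every $U\in\mathcal T^\circ$, $$H(U)A_N(U)=A_N(U)^{\sf T}H(U).$$ Moreover, $H(U)A_N(U)$ is positive definite. Consequently $A_N(U)$ is self-adjoint and positive in the inner product $\langle v_1,v_2\rangle_{H(U)}:=v_1^{\sf T}H(U)v_2$ on $\mathbb R^{N-1}$.
   Context: Moments: $U_\ell=\sum_{i=1}^Ng_i^\ell y_i$, $\ell=1,\dots,N-1$; the map $y\mapsto U$ is an affine bijection from $\{y\in[0,1]^N:\sum_iy_i=1\}$ onto the simplex $\mathcal T=\operatorname{co}\{\Gamma_1,\dots,\Gamma_N\}\subset\mathbb R^{N-1}$, $\Gamma_i=(g_i,g_i^2,\dots,g_i^{N-1})^{\sf T}$; its inverse is denoted $y(U)$. $E=\{v\in\mathbb R^N:\sum_iv_i=0\}$; $\mathsf L:E\to\mathbb R^{N-1}$, $\mathsf Lv=(\sum_ig_i^\ell v_i)_{\ell=1}^{N-1}$, is an isomorphism with inverse $\mathsf R$. Maxwell--Stefan matrix: $B_{ij}(y)=y_if_{ij}$ ($i\ne j$), $B_{ii}(y)=-\sum_{\ell\ne i}f_{i\ell}y_\ell$; $B(y)|_E:E\to E$ is invertible for every $y$ in the closed simplex. $A_N(U)=-\mathsf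 L\bigl(B(y(U))|_E\bigr)^{-1}\mathsf R\in\mathbb R^{(N-1)\times(N-1)}$. *)

theory Defs
  imports "HOL-Analysis.Analysis"
begin

text \<open>
  Species are indexed by a finite linearly ordered type \<open>'n\<close> with \<open>N\<close> elements and moments by a
  finite linearly ordered type \<open>'m\<close> with \<open>N - 1\<close> elements, so that compositions live in
  \<open>real ^ 'n\<close> and moment vectors in \<open>real ^ 'm\<close>.  The moment index that mathematically is
  \<open>\<ell> \<in> {1, \<dots>, N - 1}\<close> is recovered from an element of \<open>'m\<close> as its position in the order.
\<close>

definition mom_exp :: "'m::{finite,linorder} \<Rightarrow> nat"
  where "mom_exp l = card {..l}"

text \<open>
  The same formula gives the affine map \<open>y \<mapsto> U\<close> (restricted to the composition simplex) and the
  linear isomorphism \<open>L\<close> (restricted to the sum-zero space \<open>E\<close>).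
\<close>

definition moments :: "('n::finite \<Rightarrow> real) \<Rightarrow> real ^ 'n \<Rightarrow> real ^ ('m::{finite,linorder})"
  where "moments g v = (\<chi> l. \<Sum>i\<in>UNIV. g i ^ mom_exp l * v $ i)"

definition comp_simplex :: "(real ^ ('n::finite)) set"
  where "comp_simplex = {y. (\<forall>i. y $ i \<in> {0..1}) \<and> (\<Sum>i\<in>UNIV. y $ i) = 1}"

definition mom_vertex :: "('n::finite \<Rightarrow> real) \<Rightarrow> 'n \<Rightarrow> real ^ ('m::{finite,linorder})"
  where "mom_vertex g i = (\<chi> l. g i ^ mom_exp l)"

definition mom_simplex :: "('n::finite \<Rightarrow> real) \<Rightarrow> (real ^ ('m::{finite,linorder})) set"
  where "mom_simplex g = convex hull (range (mom_vertex g))"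

text \<open>The inverse map \<open>y(U)\<close>, meaningful for \<open>U\<close> in the moment simplex.\<close>

definition comp_of :: "('n::finite \<Rightarrow> real) \<Rightarrow> real ^ ('m::{finite,linorder}) \<Rightarrow> real ^ 'n"
  where "comp_of g U = inv_into comp_simplex (moments g) U"

definition sum_zero :: "(real ^ ('n::finite)) set"
  where "sum_zero = {v. (\<Sum>i\<in>UNIV. v $ i) = 0}"

text \<open>The inverse \<open>R\<close> of \<open>L : E \<rightarrow> \<real>\<^sup>N\<^sup>-\<^sup>1\<close>.\<close>

definition mom_lift :: "('n::finite \<Rightarrow> real) \<Rightarrow> real ^ ('m::{finite,linorder}) \<Rightarrow> real ^ 'n"
  where "mom_lift g w = inv_into sum_zero (moments g) w"

definition MS_matrix :: "('n::finite \<Rightarrow> 'n \<Rightarrow> real) \<Rightarrow> real ^ 'n \<Rightarrow> real ^ 'n ^ 'n"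
  where "MS_matrix f y =
    (\<chi> i j. if i = j then - (\<Sum>l\<in>UNIV - {i}. f i l * y $ l) else y $ i * f i j)"

definition diffusion_matrix ::
    "('n::finite \<Rightarrow> real) \<Rightarrow> ('n \<Rightarrow> 'n \<Rightarrow> real) \<Rightarrow>
      real ^ ('m::{finite,linorder}) \<Rightarrow> real ^ ('m::{finite,linorder}) ^ ('m::{finite,linorder})"
  where "diffusion_matrix g f U =
    matrix (\<lambda>w. - moments g
      (inv_into sum_zero (\<lambda>v. MS_matrix f (comp_of g U) *v v) (mom_lift g w)))"

text \<open>Since \<open>ln 0 = 0\<close>, the convention \<open>0 log 0 = 0\<close> holds on the boundary of the simplex.\<close>

definition mixing_entropy :: "('n::finite \<Rightarrow> real) \<Rightarrow> real ^ ('m::{finite,linorder}) \<Rightarrow> real"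
  where "mixing_entropy g U = (\<Sum>i\<in>UNIV. comp_of g U $ i * ln (comp_of g U $ i))"

definition hessian :: "(real ^ ('m::finite) \<Rightarrow> real) \<Rightarrow> real ^ 'm \<Rightarrow> real ^ 'm ^ 'm"
  where "hessian h U =
    (\<chi> i j. frechet_derivative (\<lambda>V. frechet_derivative h (at V) (axis j 1)) (at U) (axis i 1))"

definition pos_def :: "real ^ ('m::finite) ^ 'm \<Rightarrow> bool"
  where "pos_def M \<longleftrightarrow> transpose M = M \<and> (\<forall>v. v \<noteq> 0 \<longrightarrow> v \<bullet> (M *v v) > 0)"

definition mat_form :: "real ^ ('m::finite) ^ 'm \<Rightarrow> real ^ 'm \<Rightarrow> real ^ 'm \<Rightarrow> real"
  where "mat_form M v w = v \<bullet> (M *v w)"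

definition is_inner_product :: "('a::real_vector \<Rightarrow> 'a \<Rightarrow> real) \<Rightarrow> bool"
  where "is_inner_product b \<longleftrightarrow>
    bilinear b \<and> (\<forall>v w. b v w = b w v) \<and> (\<forall>v. v \<noteq> 0 \<longrightarrow> b v v > 0)"

end

theory Submission
  imports Defs
begin

text \<open>
  On the moment simplex \<open>y(U)\<close> is affine with linear part \<open>R\<close>, so the entropy Hessian is the
  pull-back of the weighted inner product \<open>\<Sum>\<^sub>i v\<^sub>i w\<^sub>i / y\<^sub>i\<close> on \<open>E\<close> under \<open>R\<close>.  For symmetric
  positive \<open>f\<close> the Maxwell--Stefan matrix is self-adjoint and negative definite on \<open>E\<close> for this
  inner product, hence so is its inverse, and \<open>R\<close> conjugates \<open>A\<close> to minus that inverse.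
\<close>

section \<open>Linear maps on subspaces, and matrices as bilinear forms\<close>

text \<open>Dimension count. It turns injectivity into bijectivity, once for
  \<open>moments g\<close> and once for the Maxwell-Stefan matrix, both on
  \<open>sum_zero\<close>.\<close>

lemma linear_inj_on_image_eq:
  fixes f :: "'a::euclidean_space \<Rightarrow> 'b::euclidean_space"
  assumes "linear f" "subspace S" "subspace T" "f ` S \<subseteq> T" "inj_on f S" "dim S = dim T"
  shows "f ` S = T"
proof (rule subspace_dim_equal)
  show "subspace (f ` S)"
    using assms(1,2) by (rule linear_subspace_image)
  have "dim (f ` S) = dim S"
    using assms(1,2,5) by (intro dim_image_eq) (simp_all add: span_eq_iff[THEN iffD2])
  then show "dim T \<le> dim (f ` S)"
    using assms(6) by simp
qed (use assms in auto)

text \<open>Injectivity on \<open>S\<close> forces preimages to add and scale. Composing with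
  \<open>h\<close> gives a map that is linear on a whole space, though the inverse is meaningful
  only on the image of \<open>S\<close>; \<open>h\<close> is the identity for R, and R for the
  inverse of the Maxwell-Stefan matrix.\<close>

lemma linear_inv_into_comp:
  assumes "linear f" "subspace S" "inj_on f S" "linear h" "\<And>x. h x \<in> f ` S"
  shows "linear (\<lambda>x. inv_into S f (h x))"
proof (rule linearI)
  have mem: "inv_into S f (h x) \<in> S" and val: "f (inv_into S f (h x)) = h x" for x
    using assms(5) by (auto intro: inv_into_into f_inv_into_f)
  show "inv_into S f (h (x + y)) = inv_into S f (h x) + inv_into S f (h y)" for x y
    by (rule inv_into_f_eq)
      (use assms mem val in \<open>auto simp: linear_add subspace_add\<close>)
  show "inv_into S f (h (c *\<^sub>R x)) = c *\<^sub>R inv_into S f (h x)" for c x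
    by (rule inv_into_f_eq)
      (use assms mem val in \<open>auto simp: linear_scale subspace_scale\<close>)
qed

lemma inner_transpose_mult:
  fixes M :: "real ^ 'n ^ 'm"
  shows "v \<bullet> (transpose M *v w) = (M *v v) \<bullet> w"
  by (simp add: transpose_matrix_vector dot_lmul_matrix inner_commute[of v] inner_commute[of _ w])

lemma matrix_eqI_inner:
  fixes A B :: "real ^ 'n ^ 'm"
  assumes "\<And>v w. v \<bullet> (A *v w) = v \<bullet> (B *v w)"
  shows "A = B"
proof -
  have "A *v w = B *v w" for w
    by (rule vector_eq_ldot[THEN iffD1]) (simp add: assms)
  then show ?thesis
    by (simp add: matrix_eq)
qed

lemma bilinear_mat_form: "bilinear (mat_form M)"
  unfolding mat_form_def bilinear_def
  by (auto intro!: linearI simp: inner_simps matrix_vector_right_distrib matrix_vector_mult_scaleR)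

section \<open>The moment isomorphism on the sum-zero space\<close>

text \<open>Position in the order is strictly increasing, hence an injection into a set of the same
  size.\<close>

lemma range_mom_exp: "range (mom_exp :: 'm::{finite,linorder} \<Rightarrow> nat) = {1..CARD('m)}"
proof (rule card_subset_eq)
  have "mom_exp l < mom_exp m" if "l < m" for l m :: 'm
    unfolding mom_exp_def using that by (intro psubset_card_mono) (auto simp: psubset_eq)
  then have "inj (mom_exp :: 'm \<Rightarrow> nat)"
    by (metis (no_types, lifting) injI less_irrefl linorder_neqE)
  then show "card (range (mom_exp :: 'm \<Rightarrow> nat)) = card {1..CARD('m)}"
    by (simp add: card_image)
  have "mom_exp l \<in> {1..CARD('m)}" for l :: 'm
    unfolding mom_exp_def by (auto simp: Suc_le_eq card_gt_0_iff intro!: card_mono)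
  then show "range (mom_exp :: 'm \<Rightarrow> nat) \<subseteq> {1..CARD('m)}"
    by blast
qed simp

lemma linear_moments: "linear (moments g)"
  by (rule linearI)
    (simp_all add: moments_def vec_eq_iff algebra_simps sum.distrib sum_distrib_left)

lemma sum_zero_eq_hyperplane: "sum_zero = {v. 1 \<bullet> v = 0}"
  by (simp add: sum_zero_def inner_vec_def)

lemma subspace_sum_zero: "subspace sum_zero"
  unfolding sum_zero_eq_hyperplane by (rule subspace_hyperplane)

lemma dim_sum_zero: "dim (sum_zero :: (real ^ 'n::finite) set) = CARD('n) - 1"
proof -
  have "(1 :: real ^ 'n) \<noteq> 0"
    by (simp add: vec_eq_iff)
  then show ?thesis
    unfolding sum_zero_eq_hyperplane by (subst dim_hyperplane) simp_all
qed

text \<open>Vandermonde argument by interpolation: \<open>v\<close> annihilates all powers of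
  \<open>g\<close>, hence all polynomials in \<open>g\<close>, of degree at most N - 1, and one of
  these vanishes at every node but \<open>g k\<close>.\<close>

lemma moments_eq_0_imp:
  fixes g :: "'n::finite \<Rightarrow> real" and v :: "real ^ 'n"
  assumes g: "inj g" and card: "CARD('n) = Suc CARD('m::{finite,linorder})"
    and v: "v \<in> sum_zero" and mom: "moments g v = (0 :: real ^ 'm::{finite,linorder})"
  shows "v = 0"
proof -
  \<comment> \<open>The moments supply the exponents from 1 on; exponent 0 is the sum-zero
    condition.\<close>
  have pow: "(\<Sum>i\<in>UNIV. g i ^ k * v $ i) = 0" if "k \<le> CARD('m)" for k
  proof (cases "k = 0")
    case True
    then show ?thesis using v by (simp add: sum_zero_def)
  next
    case False
    then have "k \<in> range (mom_exp :: 'm \<Rightarrow> nat)"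
      using that by (simp add: range_mom_exp)
    then obtain l :: 'm where "k = mom_exp l"
      by blast
    then show ?thesis
      using arg_cong[OF mom, of "\<lambda>w. w $ l"] by (simp add: moments_def)
  qed
  have "v $ k = 0" for k
  proof -
    \<comment> \<open>Unnormalised Lagrange polynomial of the node \<open>g k\<close>; its degree is
      the largest that \<open>pow\<close> covers.\<close>
    define p where "p = (\<Prod>j\<in>UNIV - {k}. [:- g j, 1:])"
    have "degree p = CARD('m)"
      unfolding p_def using card by (subst degree_prod_eq_sum_degree) simp_all
    then have "(\<Sum>i\<in>UNIV. poly p (g i) * v $ i)
        = (\<Sum>i\<in>UNIV. \<Sum>d\<le>CARD('m). coeff p d * (g i ^ d * v $ i))"
      by (simp add: poly_altdef sum_distrib_right mult.assoc)
    also have "\<dots> = (\<Sum>d\<le>CARD('m). coeff p d * (\<Sum>i\<in>UNIV. g i ^ d * v $ i))"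
      by (subst sum.swap) (simp add: sum_distrib_left)
    also have "\<dots> = 0"
      by (simp add: pow)
    finally have "(\<Sum>i\<in>UNIV. poly p (g i) * v $ i) = 0" .
    moreover have "poly p (g i) = 0" if "i \<noteq> k" for i
      using that by (auto simp: p_def poly_prod)
    then have "(\<Sum>i\<in>UNIV. poly p (g i) * v $ i) = (\<Sum>i\<in>{k}. poly p (g i) * v $ i)"
      by (intro sum.mono_neutral_right) auto
    moreover have "poly p (g k) \<noteq> 0"
      using g by (auto simp: p_def poly_prod inj_eq)
    ultimately show ?thesis
      by simp
  qed
  then show ?thesis
    by (simp add: vec_eq_iff)
qed

lemma inj_on_moments:
  fixes g :: "'n::finite \<Rightarrow> real"
  assumes "inj g" and "CARD('n) = Suc CARD('m::{finite,linorder})"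
  shows "inj_on (moments g :: real ^ 'n \<Rightarrow> real ^ 'm::{finite,linorder}) sum_zero"
  using moments_eq_0_imp[OF assms]
  by (simp add: linear_inj_on_iff_eq_0[OF linear_moments subspace_sum_zero])

lemma moments_image_sum_zero:
  fixes g :: "'n::finite \<Rightarrow> real"
  assumes "inj g" and "CARD('n) = Suc CARD('m::{finite,linorder})"
  shows "(moments g :: real ^ 'n \<Rightarrow> real ^ 'm::{finite,linorder}) ` sum_zero = UNIV"
  using assms
  by (intro linear_inj_on_image_eq linear_moments subspace_sum_zero inj_on_moments)
    (simp_all add: dim_sum_zero)

lemma
  fixes g :: "'n::finite \<Rightarrow> real" and w :: "real ^ ('m::{finite,linorder})"
  assumes g: "inj g" and card: "CARD('n) = Suc CARD('m)"
  shows mom_lift_in_sum_zero: "mom_lift g w \<in> sum_zero"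
    and moments_mom_lift: "moments g (mom_lift g w) = w"
    and linear_mom_lift: "linear (mom_lift g :: (real, 'm) vec \<Rightarrow> real ^ 'n)"
proof -
  have im: "x \<in> moments g ` sum_zero" for x :: "(real, 'm) vec"
    using moments_image_sum_zero[OF assms] by blast
  show "mom_lift g w \<in> sum_zero" "moments g (mom_lift g w) = w"
    unfolding mom_lift_def using im by (auto intro: inv_into_into f_inv_into_f)
  show "linear (mom_lift g :: (real, 'm) vec \<Rightarrow> real ^ 'n)"
    unfolding mom_lift_def
    using linear_inv_into_comp[OF linear_moments subspace_sum_zero inj_on_moments[OF assms]
        linear_id] im by simp
qed

lemma mom_lift_moments:
  fixes g :: "'n::finite \<Rightarrow> real"
  assumes "inj g" and "CARD('n) = Suc CARD('m::{finite,linorder})" and "v \<in> sum_zero"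
  shows "mom_lift g (moments g v :: real ^ 'm::{finite,linorder}) = v"
  unfolding mom_lift_def using inj_on_moments[OF assms(1,2)] assms(3) by (rule inv_into_f_f)

section \<open>Compositions over the moment simplex\<close>

text \<open>The vertices are the moments of the unit vectors, and a linear image of a convex set is
  convex. Hence \<open>comp_of\<close> is a genuine preimage on the moment simplex.\<close>

lemma mom_simplex_subset:
  "mom_simplex g \<subseteq> moments g ` (comp_simplex :: (real ^ 'n::finite) set)"
  unfolding mom_simplex_def
proof (rule hull_minimal)
  have "convex (comp_simplex :: (real ^ 'n) set)"
    unfolding convex_alt comp_simplex_def
    by (auto simp: sum.distrib sum_distrib_left[symmetric] intro!: convex_bound_le)
  then show "convex (moments g ` (comp_simplex :: (real ^ 'n) set))"
    by (intro convex_linear_image linear_moments)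
  have "mom_vertex g i = moments g (axis i 1)" for i
    by (simp add: mom_vertex_def moments_def axis_def if_distrib cong: if_cong)
  moreover have "axis i 1 \<in> (comp_simplex :: (real ^ 'n) set)" for i
    by (simp add: comp_simplex_def axis_def)
  ultimately show "range (mom_vertex g) \<subseteq> moments g ` (comp_simplex :: (real ^ 'n) set)"
    by auto
qed

lemma
  fixes g :: "'n::finite \<Rightarrow> real"
  assumes "V \<in> mom_simplex g"
  shows comp_of_in_comp_simplex: "comp_of g V \<in> comp_simplex"
    and moments_comp_of: "moments g (comp_of g V) = V"
  using assms mom_simplex_subset[of g]
  by (auto simp: comp_of_def intro!: inv_into_into f_inv_into_f)

text \<open>Two compositions differ by a sum-zero vector, which its moments \<open>V - U\<close>
  determine. So y(U) is affine with linear part R.\<close>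

lemma comp_of_eq:
  fixes g :: "'n::finite \<Rightarrow> real" and U V :: "real ^ ('m::{finite,linorder})"
  assumes "inj g" and "CARD('n) = Suc CARD('m::{finite,linorder})"
    and U: "U \<in> mom_simplex g" and V: "V \<in> mom_simplex g"
  shows "comp_of g V = comp_of g U + mom_lift g (V - U)"
proof -
  have "comp_of g V - comp_of g U \<in> sum_zero"
    using comp_of_in_comp_simplex[OF U] comp_of_in_comp_simplex[OF V]
    by (simp add: comp_simplex_def sum_zero_def sum_subtractf)
  from mom_lift_moments[where 'm = 'm, OF assms(1,2) this] show ?thesis
    by (simp add: linear_diff[OF linear_moments] moments_comp_of U V)
qed

text \<open>If species \<open>i\<close> were absent, draining it further would leave the composition
  simplex, yet an interior \<open>U\<close> can move slightly in every direction.\<close>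

lemma comp_of_pos:
  fixes g :: "'n::finite \<Rightarrow> real" and U :: "real ^ ('m::{finite,linorder})"
  assumes g: "inj g" and card: "CARD('n) = Suc CARD('m::{finite,linorder})"
    and U: "U \<in> interior (mom_simplex g)"
  shows "0 < comp_of g U $ i"
proof (rule ccontr)
  have Us: "U \<in> mom_simplex g"
    using U interior_subset by blast
  assume "\<not> 0 < comp_of g U $ i"
  with comp_of_in_comp_simplex[OF Us] have zero: "comp_of g U $ i = 0"
    by (auto simp: comp_simplex_def not_less intro: antisym)
  \<comment> \<open>The type \<open>'m\<close> is nonempty, so a second species exists to receive
    the mass.\<close>
  have "CARD('n) \<noteq> 1"
    using card by simp
  then obtain j where "j \<noteq> i"
    by (metis (full_types) UNIV_I UNIV_eq_I card_1_singleton_iff One_nat_def insertI1)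
  define v :: "real ^ 'n" where "v = axis j 1 - axis i 1"
  have v: "v \<in> sum_zero" and vi: "v $ i = - 1"
    using \<open>j \<noteq> i\<close> by (simp_all add: v_def sum_zero_def axis_def sum_subtractf)
  define w :: "(real, 'm) vec" where "w = moments g v"
  obtain e where "e > 0" and e: "cball U e \<subseteq> mom_simplex g"
    using U by (auto simp: mem_interior_cball)
  \<comment> \<open>The summand 1 guards against a zero norm; \<open>t\<close> is small enough to
    stay in the ball.\<close>
  define t where "t = e / (norm w + 1)"
  have w1: "norm w + 1 > 0"
    by (simp add: add_nonneg_pos)
  then have "t > 0"
    using \<open>e > 0\<close> by (simp add: t_def)
  have "t * norm w \<le> e"
    using w1 \<open>e > 0\<close> by (simp add: t_def pos_divide_le_eq distrib_left)
  then have "U + t *\<^sub>R w \<in> mom_simplex g"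
    using e \<open>t > 0\<close> by (auto simp: dist_norm)
  note V = this
  have "comp_of g (U + t *\<^sub>R w) = comp_of g U + t *\<^sub>R v"
    using comp_of_eq[OF g card Us V]
    by (simp add: linear_scale[OF linear_mom_lift[OF g card]] w_def mom_lift_moments[OF g card v])
  then have "comp_of g (U + t *\<^sub>R w) $ i < 0"
    using zero vi \<open>t > 0\<close> by simp
  then show False
    using comp_of_in_comp_simplex[OF V] by (auto simp: comp_simplex_def not_less[symmetric])
qed

section \<open>The Hessian of the mixing entropy\<close>

text \<open>Chain rule for an affine inner map: t ln t has second derivative 1/t, and the linear
  part of y(U) is \<open>mom_lift g\<close>.\<close>

lemma mat_form_hessian_mixing_entropy:
  fixes g :: "'n::finite \<Rightarrow> real" and U :: "real ^ ('m::{finite,linorder})"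
  assumes g: "inj g" and card: "CARD('n) = Suc CARD('m::{finite,linorder})"
    and U: "U \<in> interior (mom_simplex g)"
  shows "mat_form (hessian (mixing_entropy g) U) v w
    = (\<Sum>k\<in>UNIV. mom_lift g v $ k * mom_lift g w $ k / comp_of g U $ k)"
proof -
  let ?S = "interior (mom_simplex g) :: ((real, 'm) vec) set"
  note lin = linear_mom_lift[OF g card]
  \<comment> \<open>Affine on the whole space, unlike \<open>comp_of g\<close>, whose values off the
    simplex are arbitrary choices of \<open>inv_into\<close>.\<close>
  define P where "P V = comp_of g U + mom_lift g (V - U)" for V :: "(real, 'm) vec"
  have P: "comp_of g V = P V" if "V \<in> ?S" for V
    unfolding P_def using that U interior_subset by (intro comp_of_eq[OF g card]) blast+
  have pos: "P V $ k > 0" if "V \<in> ?S" for V k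
    using comp_of_pos[OF g card that] P[OF that] by simp
  have dP: "((\<lambda>V. P V $ k) has_derivative (\<lambda>x. mom_lift g x $ k)) (at V)" for V k
  proof -
    have "(mom_lift g has_derivative mom_lift g) (at (V - U))"
      using lin by (intro linear_imp_has_derivative)
    then have "((\<lambda>V. mom_lift g (V - U)) has_derivative (\<lambda>x. mom_lift g x)) (at V)"
      by (rule has_derivative_compose[rotated]) (auto intro!: derivative_eq_intros)
    then show ?thesis
      unfolding P_def
      by (auto intro!: derivative_eq_intros bounded_linear.has_derivative[OF bounded_linear_vec_nth])
  qed
  define G where "G V x = (\<Sum>k\<in>UNIV. (ln (P V $ k) + 1) * mom_lift g x $ k)" for V x :: "(real, 'm) vec"
  have "frechet_derivative (mixing_entropy g) (at V) = G V" if V: "V \<in> ?S" for V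
  proof -
    have "((\<lambda>V. \<Sum>k\<in>UNIV. P V $ k * ln (P V $ k)) has_derivative G V) (at V)"
      unfolding G_def
      by (rule derivative_eq_intros dP pos[OF V] refl)+
        (use pos[OF V] in \<open>auto simp: fun_eq_iff field_simps less_imp_neq[symmetric] intro!: sum.cong\<close>)
    \<comment> \<open>A derivative depends only on a neighbourhood, and on the open interior
      \<open>P\<close> agrees with \<open>comp_of g\<close>.\<close>
    then have "(mixing_entropy g has_derivative G V) (at V)"
      by (rule has_derivative_transform_within_open[OF _ open_interior V])
        (simp add: mixing_entropy_def P)
    then show ?thesis
      by (rule frechet_derivative_at[symmetric])
  qed
  note grad = this
  define b where "b v w = (\<Sum>k\<in>UNIV. mom_lift g v $ k * mom_lift g w $ k / comp_of g U $ k)"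
    for v w :: "(real, 'm) vec"
  have "hessian (mixing_entropy g) U $ i $ j = b (axis i 1) (axis j 1)" for i j
  proof -
    have "((\<lambda>V. G V (axis j 1)) has_derivative (\<lambda>x. b x (axis j 1))) (at U)"
      unfolding G_def b_def P[OF U]
      by (rule derivative_eq_intros dP pos[OF U] refl)+
        (auto simp: fun_eq_iff field_simps)
    then have "((\<lambda>V. frechet_derivative (mixing_entropy g) (at V) (axis j 1))
        has_derivative (\<lambda>x. b x (axis j 1))) (at U)"
      by (rule has_derivative_transform_within_open[OF _ open_interior U]) (simp add: grad)
    from frechet_derivative_at[OF this, symmetric] show ?thesis
      by (simp add: hessian_def)
  qed
  note entries = this
  \<comment> \<open>The entries fix the values on unit vectors; bilinearity extends them to all
    \<open>v\<close> and \<open>w\<close>.\<close>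
  have "mat_form (hessian (mixing_entropy g) U) = b"
  proof (rule bilinear_eq_stdbasis)
    show "bilinear (mat_form (hessian (mixing_entropy g) U))"
      by (rule bilinear_mat_form)
    show "bilinear b"
      unfolding b_def bilinear_def
      by (auto intro!: linearI simp: linear_add[OF lin] linear_scale[OF lin] sum_distrib_left
          sum.distrib[symmetric] add_divide_distrib algebra_simps)
    show "mat_form (hessian (mixing_entropy g) U) x y = b x y"
      if "x \<in> Basis" "y \<in> Basis" for x y
      using that
      by (auto simp: Basis_vec_def mat_form_def matrix_vector_mult_basis inner_axis' column_def entries)
  qed
  then show ?thesis
    by (simp add: b_def)
qed

section \<open>The Maxwell-Stefan matrix on the sum-zero space\<close>

text \<open>
  In the variables \<open>v\<^sub>i / y\<^sub>i\<close>, \<open>MS_matrix f y\<close> is minus a graph Laplacian with edge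
  weights \<open>f\<^sub>i\<^sub>j y\<^sub>i y\<^sub>j\<close>.
\<close>

lemma MS_matrix_form:
  fixes y v w :: "real ^ 'n::finite"
  assumes y: "\<And>i. y $ i \<noteq> 0" and f: "\<And>i j. f i j = f j i"
  shows "(\<Sum>i\<in>UNIV. w $ i * (MS_matrix f y *v v) $ i / y $ i) =
    - (\<Sum>i\<in>UNIV. \<Sum>j\<in>UNIV - {i}. f i j * y $ i * y $ j *
        (w $ i / y $ i - w $ j / y $ j) * (v $ i / y $ i - v $ j / y $ j)) / 2"
proof -
  define z where "z i = v $ i / y $ i" for i
  define x where "x i = w $ i / y $ i" for i
  have v: "v $ i = y $ i * z i" and w: "w $ i = y $ i * x i" for i
    using y by (simp_all add: z_def x_def)
  \<comment> \<open>The zero diagonal lets double sums run over the full square, where the indices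
    can be swapped.\<close>
  define c where "c i j = (if i = j then 0 else f i j * y $ i * y $ j)" for i j
  have c: "c i j = c j i" for i j
    using f by (simp add: c_def)
  \<comment> \<open>The diagonal entry is spread over the off-diagonal terms, turning each
    \<open>z j\<close> into \<open>z j - z i\<close>.\<close>
  have row: "(MS_matrix f y *v v) $ i = (\<Sum>j\<in>UNIV. c i j * (z j - z i))" for i
  proof -
    have "(MS_matrix f y *v v) $ i
        = MS_matrix f y $ i $ i * v $ i + (\<Sum>j\<in>UNIV - {i}. MS_matrix f y $ i $ j * v $ j)"
      by (simp add: matrix_vector_mult_def sum.remove[of UNIV i])
    also have "MS_matrix f y $ i $ i * v $ i = (\<Sum>j\<in>UNIV - {i}. - (f i j * y $ j * v $ i))"
      by (simp add: MS_matrix_def sum_distrib_right sum_negf)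
    also have "\<dots> + (\<Sum>j\<in>UNIV - {i}. MS_matrix f y $ i $ j * v $ j)
        = (\<Sum>j\<in>UNIV - {i}. c i j * (z j - z i))"
      unfolding sum.distrib[symmetric]
      by (intro sum.cong) (auto simp: MS_matrix_def c_def v algebra_simps)
    also have "\<dots> = (\<Sum>j\<in>UNIV. c i j * (z j - z i))"
      by (intro sum.mono_neutral_left) (auto simp: c_def)
    finally show ?thesis .
  qed
  define S where "S = (\<Sum>i\<in>UNIV. \<Sum>j\<in>UNIV. c i j * x i * (z j - z i))"
  have lhs: "(\<Sum>i\<in>UNIV. w $ i * (MS_matrix f y *v v) $ i / y $ i) = S"
    unfolding S_def by (simp add: row x_def sum_distrib_left sum_divide_distrib mult_ac)
  \<comment> \<open>Symmetrisation: adding the copy with swapped indices turns \<open>x i\<close>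
    into \<open>x i - x j\<close>.\<close>
  have "S = (\<Sum>i\<in>UNIV. \<Sum>j\<in>UNIV. c j i * x j * (z i - z j))"
    unfolding S_def by (rule sum.swap)
  then have "2 * S = (\<Sum>i\<in>UNIV. \<Sum>j\<in>UNIV. c i j * x i * (z j - z i) + c i j * x j * (z i - z j))"
    unfolding S_def by (simp add: sum.distrib c)
  also have "\<dots> = - (\<Sum>i\<in>UNIV. \<Sum>j\<in>UNIV. c i j * (x i - x j) * (z i - z j))"
    by (simp add: sum_negf[symmetric] algebra_simps)
  also have "(\<Sum>i\<in>UNIV. \<Sum>j\<in>UNIV. c i j * (x i - x j) * (z i - z j))
      = (\<Sum>i\<in>UNIV. \<Sum>j\<in>UNIV - {i}. f i j * y $ i * y $ j * (x i - x j) * (z i - z j))"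
  proof (rule sum.cong)
    show "(\<Sum>j\<in>UNIV. c i j * (x i - x j) * (z i - z j))
      = (\<Sum>j\<in>UNIV - {i}. f i j * y $ i * y $ j * (x i - x j) * (z i - z j))" for i
      by (rule sum.mono_neutral_cong_right) (auto simp: c_def)
  qed simp
  finally show ?thesis
    unfolding lhs x_def z_def by simp
qed

text \<open>The Laplacian expression is visibly symmetric in \<open>v\<close> and
  \<open>w\<close>.\<close>

lemma MS_matrix_form_sym:
  fixes y v w :: "real ^ 'n::finite"
  assumes y: "\<And>i. y $ i \<noteq> 0" and f: "\<And>i j. f i j = f j i"
  shows "(\<Sum>i\<in>UNIV. w $ i * (MS_matrix f y *v v) $ i / y $ i)
    = (\<Sum>i\<in>UNIV. v $ i * (MS_matrix f y *v w) $ i / y $ i)"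
  unfolding MS_matrix_form[OF y f] by (simp add: mult_ac)

text \<open>The Laplacian form is minus a sum of weighted squares, zero only if \<open>v\<close> is
  a multiple of \<open>y\<close>; the total of \<open>y\<close> is 1 and that of \<open>v\<close> is
  0, so such a \<open>v\<close> vanishes.\<close>

lemma MS_matrix_form_neg:
  fixes y v :: "real ^ 'n::finite"
  assumes y: "\<And>i. y $ i > 0" and sum_y: "(\<Sum>i\<in>UNIV. y $ i) = 1"
    and f: "\<And>i j. f i j = f j i" and f_pos: "\<And>i j. i \<noteq> j \<Longrightarrow> f i j > 0"
    and v: "v \<in> sum_zero" "v \<noteq> 0"
  shows "(\<Sum>i\<in>UNIV. v $ i * (MS_matrix f y *v v) $ i / y $ i) < 0"
proof -
  define z where "z i = v $ i / y $ i" for i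
  have y0: "y $ i \<noteq> 0" for i
    using y[of i] by simp
  let ?T = "\<lambda>i j. f i j * y $ i * y $ j * (z i - z j) * (z i - z j)"
  have nonneg: "?T i j \<ge> 0" if "i \<noteq> j" for i j
    using y f_pos[OF that] by (simp add: mult.assoc less_imp_le)
  have "\<exists>i j. z i \<noteq> z j"
  proof (rule ccontr)
    assume "\<not> (\<exists>i j. z i \<noteq> z j)"
    then obtain a where "\<And>i. z i = a"
      by metis
    then have eq: "v $ i = a * y $ i" for i
      using y0 by (simp add: z_def field_simps)
    then have "a = 0"
      using v(1) sum_y by (simp add: sum_zero_def sum_distrib_left[symmetric])
    with eq v(2) show False
      by (simp add: vec_eq_iff)
  qed
  then obtain i j where ij: "z i \<noteq> z j"
    by blast
  then have "?T i j > 0"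
    using y[of i] y[of j] f_pos[of i j] by (auto simp: mult.assoc zero_less_mult_iff)
  with ij have "(\<Sum>j\<in>UNIV - {i}. ?T i j) > 0"
    by (intro sum_pos2[of _ j]) (auto intro: nonneg)
  moreover have "(\<Sum>j\<in>UNIV - {i}. ?T i j) \<ge> 0" for i
    by (intro sum_nonneg nonneg) auto
  ultimately have "(\<Sum>i\<in>UNIV. \<Sum>j\<in>UNIV - {i}. ?T i j) > 0"
    using sum_pos2[of UNIV i "\<lambda>i. \<Sum>j\<in>UNIV - {i}. ?T i j"] by simp
  then show ?thesis
    unfolding MS_matrix_form[OF y0 f] z_def by simp
qed

text \<open>Testing the form with \<open>w = y\<close> makes all differences of
  \<open>w $ i / y $ i\<close> vanish, while the left side becomes the total of the image
  vector.\<close>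

lemma MS_matrix_in_sum_zero:
  fixes y v :: "real ^ 'n::finite"
  assumes y: "\<And>i. y $ i \<noteq> 0" and f: "\<And>i j. f i j = f j i"
  shows "MS_matrix f y *v v \<in> sum_zero"
  using MS_matrix_form[OF y f, where w = y and v = v] y by (simp add: sum_zero_def)

text \<open>A nonzero kernel vector in \<open>sum_zero\<close> would make a negative form
  zero.\<close>

lemma inj_on_MS_matrix:
  fixes y :: "real ^ 'n::finite"
  assumes y: "\<And>i. y $ i > 0" and sum_y: "(\<Sum>i\<in>UNIV. y $ i) = 1"
    and f: "\<And>i j. f i j = f j i" and f_pos: "\<And>i j. i \<noteq> j \<Longrightarrow> f i j > 0"
  shows "inj_on (\<lambda>v. MS_matrix f y *v v) sum_zero"
  using MS_matrix_form_neg[where f = f, OF y sum_y f f_pos]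
  by (subst linear_inj_on_iff_eq_0[OF matrix_vector_mul_linear subspace_sum_zero])
    (metis (no_types, lifting) div_0 less_irrefl mult_zero_right sum.neutral zero_index)

lemma MS_matrix_image_sum_zero:
  fixes y :: "real ^ 'n::finite"
  assumes y: "\<And>i. y $ i > 0" and sum_y: "(\<Sum>i\<in>UNIV. y $ i) = 1"
    and f: "\<And>i j. f i j = f j i" and f_pos: "\<And>i j. i \<noteq> j \<Longrightarrow> f i j > 0"
  shows "(\<lambda>v. MS_matrix f y *v v) ` sum_zero = sum_zero"
proof (intro linear_inj_on_image_eq)
  show "(\<lambda>v. MS_matrix f y *v v) ` sum_zero \<subseteq> sum_zero"
    using y by (auto intro!: MS_matrix_in_sum_zero f simp: less_imp_neq[symmetric])
  show "inj_on (\<lambda>v. MS_matrix f y *v v) sum_zero"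
    using assms by (rule inj_on_MS_matrix)
qed (simp_all add: subspace_sum_zero)

section \<open>Self-adjointness and positivity of the diffusion matrix\<close>

theorem theorem8p1:
  fixes N :: nat
    and g :: "'n::{finite,linorder} \<Rightarrow> real"
    and f :: "'n \<Rightarrow> 'n \<Rightarrow> real"
    and U :: "real ^ ('m::{finite,linorder})"
  assumes "N \<ge> 2" and "CARD('n) = N" and "CARD('m) = N - 1"
    and "\<And>i. 0 < g i" and "strict_mono g"
    and "\<And>i j. i \<noteq> j \<Longrightarrow> f i j = g i + g j"
    and "U \<in> interior (mom_simplex g)"
  shows "let A = diffusion_matrix g f U; H = hessian (mixing_entropy g) U in
      H ** A = transpose A ** H
    \<and> pos_def (H ** A)
    \<and> is_inner_product (mat_form H)
    \<and> (\<forall>v w. mat_form H (A *v v) w = mat_form H v (A *v w))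
    \<and> (\<forall>v. v \<noteq> 0 \<longrightarrow> mat_form H (A *v v) v > 0)"
proof -
  define A where "A = diffusion_matrix g f U"
  define H where "H = hessian (mixing_entropy g) U"
  define y where "y = comp_of g U"
  \<comment> \<open>The inverse of the Maxwell-Stefan matrix on E, applied after R; not the moment
    isomorphism, which is \<open>moments g\<close>.\<close>
  define L where "L = (\<lambda>w :: (real, 'm) vec. inv_into sum_zero (\<lambda>v. MS_matrix f y *v v) (mom_lift g w))"
  have g: "inj g"
    using assms(5) by (rule strict_mono_imp_inj_on)
  have card: "CARD('n) = Suc CARD('m)"
    using assms(1-3) by simp
  have f: "f i j = f j i" for i j
    using assms(6)[of i j] assms(6)[of j i] by (cases "i = j") simp_all
  have f_pos: "f i j > 0" if "i \<noteq> j" for i j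
    using assms(4)[of i] assms(4)[of j] assms(6)[OF that] by simp
  have y: "y $ i > 0" for i
    unfolding y_def by (rule comp_of_pos[OF g card assms(7)])
  have y0: "y $ i \<noteq> 0" for i
    using y[of i] by simp
  have sum_y: "(\<Sum>i\<in>UNIV. y $ i) = 1"
    using comp_of_in_comp_simplex[of U g] assms(7) interior_subset
    by (auto simp: y_def comp_simplex_def)
  have B_im: "(\<lambda>v. MS_matrix f y *v v) ` sum_zero = sum_zero"
    using y sum_y f f_pos by (rule MS_matrix_image_sum_zero)
  have B_inj: "inj_on (\<lambda>v. MS_matrix f y *v v) sum_zero"
    using y sum_y f f_pos by (rule inj_on_MS_matrix)
  have lift_im: "mom_lift g w \<in> (\<lambda>v. MS_matrix f y *v v) ` sum_zero" for w :: "(real, 'm) vec"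
    unfolding B_im by (rule mom_lift_in_sum_zero[OF g card])
  have L_mem: "L w \<in> sum_zero" and BL: "MS_matrix f y *v L w = mom_lift g w" for w :: "(real, 'm) vec"
    unfolding L_def using inv_into_into[OF lift_im[of w]] f_inv_into_f[OF lift_im[of w]] by auto
  have "linear L"
    unfolding L_def
    by (intro linear_inv_into_comp linear_mom_lift[OF g card] subspace_sum_zero lift_im
        B_inj matrix_vector_mul_linear)
  \<comment> \<open>Linearity is what lets \<open>matrix\<close> represent this map.\<close>
  then have "linear (\<lambda>w. - moments g (L w) :: (real, 'm) vec)"
    using linear_compose[OF \<open>linear L\<close> linear_moments[of g]]
    by (intro linear_compose_neg) (simp add: o_def)
  then have A: "A *v w = - moments g (L w)" for w
    unfolding A_def diffusion_matrix_def L_def y_def by (simp add: matrix_works)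
  \<comment> \<open>R undoes the moments because \<open>L w\<close> lies in E.\<close>
  have lift_A: "mom_lift g (A *v w) = - L w" for w
    by (simp add: A linear_neg[OF linear_mom_lift[OF g card]] mom_lift_moments[OF g card L_mem])
  have H: "mat_form H v w = (\<Sum>k\<in>UNIV. mom_lift g v $ k * mom_lift g w $ k / y $ k)" for v w
    unfolding H_def y_def by (rule mat_form_hessian_mixing_entropy[OF g card assms(7)])
  have H_sym: "mat_form H v w = mat_form H w v" for v w
    by (simp add: H mult.commute)
  have lift_0: "mom_lift g v \<noteq> 0" if "v \<noteq> 0" for v :: "(real, 'm) vec"
    using moments_mom_lift[OF g card, of v] linear_0[OF linear_moments[of g]] that by auto
  have H_pos: "mat_form H v v > 0" if v: "v \<noteq> 0" for v
  proof -
    obtain k where "mom_lift g v $ k \<noteq> 0"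
      using lift_0[OF v] by (auto simp: vec_eq_iff)
    then show ?thesis
      unfolding H using y[of k]
      by (intro sum_pos2[of _ k]) (auto simp: y less_imp_le zero_less_divide_iff zero_less_mult_iff)
  qed
  \<comment> \<open>Key identity: rewriting R w as the Maxwell-Stefan image of \<open>L w\<close>
    turns the form of A into minus the Maxwell-Stefan form at \<open>L v\<close> and
    \<open>L w\<close>.\<close>
  have HA: "mat_form H (A *v v) w = - (\<Sum>k\<in>UNIV. L v $ k * (MS_matrix f y *v L w) $ k / y $ k)" for v w
    by (simp add: H lift_A BL sum_negf)
  have selfadj: "mat_form H (A *v v) w = mat_form H v (A *v w)" for v w
  proof -
    have "mat_form H (A *v v) w = mat_form H (A *v w) v"
      unfolding HA by (intro arg_cong[where f = uminus] MS_matrix_form_sym y0 f)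
    also have "\<dots> = mat_form H v (A *v w)"
      by (rule H_sym)
    finally show ?thesis .
  qed
  have A_pos: "mat_form H (A *v v) v > 0" if v: "v \<noteq> 0" for v
  proof -
    have "L v \<noteq> 0"
      using BL[of v] lift_0[OF v] by auto
    with y sum_y f f_pos L_mem
    have "(\<Sum>k\<in>UNIV. L v $ k * (MS_matrix f y *v L v) $ k / y $ k) < 0"
      by (rule MS_matrix_form_neg)
    then show ?thesis
      by (simp add: HA)
  qed
  have H_transpose: "transpose H = H"
  proof (rule matrix_eqI_inner)
    show "v \<bullet> (transpose H *v w) = v \<bullet> (H *v w)" for v w
      unfolding inner_transpose_mult using H_sym[of v w] by (simp add: mat_form_def inner_commute)
  qed
  \<comment> \<open>Self-adjointness of A, with A moved across the dot product as its
    transpose.\<close>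
  have comm: "H ** A = transpose A ** H"
  proof (rule matrix_eqI_inner)
    fix w v
    show "w \<bullet> ((H ** A) *v v) = w \<bullet> ((transpose A ** H) *v v)"
      using selfadj[of w v]
      unfolding mat_form_def matrix_vector_mul_assoc[symmetric] inner_transpose_mult by (rule sym)
  qed
  have "pos_def (H ** A)"
    unfolding pos_def_def
  proof (intro conjI allI impI)
    show "transpose (H ** A) = H ** A"
      using comm by (simp add: matrix_transpose_mul H_transpose)
    show "0 < v \<bullet> ((H ** A) *v v)" if "v \<noteq> 0" for v
      using A_pos[OF that] unfolding selfadj by (simp add: mat_form_def matrix_vector_mul_assoc)
  qed
  then show ?thesis
    using comm bilinear_mat_form[of H] H_sym H_pos selfadj A_pos
    unfolding A_def[symmetric] H_def[symmetric] Let_def is_inner_product_def by blast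
qed

end
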